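(* Let $X:U\subset\mathbb{R}^2\to\mathbb{R}^3$ be a surface of revolution $$X(u,s)=(\phi(s)\cos u,\ \phi(s)\sin u,\ \psi(s)),$$ where $\phi,\psi$ are smooth real functions, and let $b,c\in\mathbb{R}$. Then $X$ is an initial datum for the mean curvature flow moving by a homothetic helicoidal motion $L(t)$ about the $z$-axis with dilation rate $\sigma'(0)=c$ and translation rate $\Theta'(0)=b\,(0,0,1)$ (i.e. there exists such a motion for which $\widehat X^t=L(t)X$ is a self-similar solution to the mean curvature flow with $\widehat X^0=X$) if and only if the curvature $\kappa$ of the plane curve $\alpha(s)=(0,\phi(s),\psi(s))$ is given by $$\kappa=\frac{1}{|\tau|}\left(2c\,\langle\alpha,\eta\rangle+2b\,\langle e_3,\eta\rangle+\frac{1}{\phi}\langle e_3,\tau\rangle\right),$$ where $\tau=\alpha'$, $\eta=(0,\psi',-\phi')$ and $e_3=(0,0,1)$.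
   Context: All maps are smooth and surfaces are immersions (so $\phi\neq0$ and $(\phi',\psi')\ne(0,0)$). The curvature of $\alpha$ is taken with the sign convention $\kappa=\dfrac{\phi''\psi'-\psi''\phi'}{(\phi'^2+\psi'^2)^{3/2}}$. For an immersed surface with unit normal $N$, first fundamental form coefficients $E,F,G$ and second fundamental form coefficients $e,f,g$ with respect to $N$, the mean curvature is $H=\dfrac{Eg-2fF+Ge}{2(EG-F^2)}$ (half the trace of the shape operator). A homothetic helicoidal motion about the $z$-axis is a family of maps $L(t)x=\sigma(t)\Gamma(t)x+\Theta(t)$, $t\in\mathfrak I$ (an interval containing $0$), where $\sigma:\mathfrak I\to(0,\infty)$ is differentiable with $\sigma(0)=1$, $\Gamma(t)$ is the rotation about the $z$-axis by angle $\xi(t)$ with $\xi$ differentiable and $\xi(0)=0$, and $\Theta(t)=(0,0,\zeta(t))$ with $\zeta$ differentiable and $\zeta(0)=0$. Thus $\Theta'(0)=b(0,0,1)$ with $b=\zeta'(0)$, and $c=\sigma'(0)$. The family $\widehat X^t=L(t)X$ is a self-similar solution to the mean curvature flow if $\langle\partial_t\widehat X^t,N^t\rangle=H^t$ for all $t\in\mathfrak I$ and at all points, where $N^t$ is a unit normal of $\widehat X^t$ and $H^t$ its mean curvature with respect to $N^t$. *)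

theory Defs
  imports "HOL-Analysis.Analysis"
begin

text \<open>Meant for open \<open>S\<close>, where \<^const>\<open>deriv\<close> depends only on the values of \<open>f\<close> on \<open>S\<close>.\<close>

definition smooth_on :: "real set \<Rightarrow> (real \<Rightarrow> real) \<Rightarrow> bool" where
  "smooth_on S f \<longleftrightarrow> (\<forall>n. \<forall>x\<in>S. (deriv ^^ n) f differentiable (at x))"

definition e3 :: "real ^ 3" where
  "e3 = vector [0, 0, 1]"


subsection \<open>Parametrized surfaces\<close>

definition immersion_on :: "(real \<times> real) set \<Rightarrow> (real \<times> real \<Rightarrow> real ^ 3) \<Rightarrow> bool" where
  "immersion_on U X \<longleftrightarrow> (\<forall>p\<in>U. \<exists>D. (X has_derivative D) (at p) \<and> inj D)"

definition pd1 :: "(real \<times> real \<Rightarrow> real ^ 3) \<Rightarrow> real \<times> real \<Rightarrow> real ^ 3" where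
  "pd1 X = (\<lambda>(u, s). vector_derivative (\<lambda>v. X (v, s)) (at u))"

definition pd2 :: "(real \<times> real \<Rightarrow> real ^ 3) \<Rightarrow> real \<times> real \<Rightarrow> real ^ 3" where
  "pd2 X = (\<lambda>(u, s). vector_derivative (\<lambda>v. X (u, v)) (at s))"

text \<open>
  A continuous unit normal of a smooth immersion agrees locally, up to sign, with the normalized
  cross product of the partial derivatives, so it is automatically smooth.
\<close>

definition unit_normal_on ::
    "(real \<times> real) set \<Rightarrow> (real \<times> real \<Rightarrow> real ^ 3) \<Rightarrow> (real \<times> real \<Rightarrow> real ^ 3) \<Rightarrow> bool" where
  "unit_normal_on U X N \<longleftrightarrow> continuous_on U N \<and>
     (\<forall>p\<in>U. norm (N p) = 1 \<and> N p \<bullet> pd1 X p = 0 \<and> N p \<bullet> pd2 X p = 0)"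

definition mean_curvature ::
    "(real \<times> real \<Rightarrow> real ^ 3) \<Rightarrow> (real \<times> real \<Rightarrow> real ^ 3) \<Rightarrow> real \<times> real \<Rightarrow> real" where
  "mean_curvature X N p =
    (let E = pd1 X p \<bullet> pd1 X p;
         F = pd1 X p \<bullet> pd2 X p;
         G = pd2 X p \<bullet> pd2 X p;
         e = pd1 (pd1 X) p \<bullet> N p;
         f = pd2 (pd1 X) p \<bullet> N p;
         g = pd2 (pd2 X) p \<bullet> N p
     in (E * g - 2 * f * F + G * e) / (2 * (E * G - F\<^sup>2)))"

definition surface_of_revolution ::
    "(real \<Rightarrow> real) \<Rightarrow> (real \<Rightarrow> real) \<Rightarrow> real \<times> real \<Rightarrow> real ^ 3" where
  "surface_of_revolution \<phi> \<psi> = (\<lambda>(u, s). vector [\<phi> s * cos u, \<phi> s * sin u, \<psi> s])"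


subsection \<open>The profile curve\<close>

definition profile_curve :: "(real \<Rightarrow> real) \<Rightarrow> (real \<Rightarrow> real) \<Rightarrow> real \<Rightarrow> real ^ 3" where
  "profile_curve \<phi> \<psi> s = vector [0, \<phi> s, \<psi> s]"

definition profile_tangent :: "(real \<Rightarrow> real) \<Rightarrow> (real \<Rightarrow> real) \<Rightarrow> real \<Rightarrow> real ^ 3" where
  "profile_tangent \<phi> \<psi> s = vector_derivative (profile_curve \<phi> \<psi>) (at s)"

definition profile_normal :: "(real \<Rightarrow> real) \<Rightarrow> (real \<Rightarrow> real) \<Rightarrow> real \<Rightarrow> real ^ 3" where
  "profile_normal \<phi> \<psi> s = vector [0, deriv \<psi> s, - deriv \<phi> s]"

text \<open>
  The sign is opposite to the usual one for the plane curve \<open>(\<phi>, \<psi>)\<close>: this is the curvature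
  with respect to the (unnormalized) normal \<^const>\<open>profile_normal\<close>.
\<close>

definition profile_curvature :: "(real \<Rightarrow> real) \<Rightarrow> (real \<Rightarrow> real) \<Rightarrow> real \<Rightarrow> real" where
  "profile_curvature \<phi> \<psi> s =
     (deriv (deriv \<phi>) s * deriv \<psi> s - deriv (deriv \<psi>) s * deriv \<phi> s) /
     ((deriv \<phi> s)\<^sup>2 + (deriv \<psi> s)\<^sup>2) powr (3 / 2)"


subsection \<open>Homothetic helicoidal motions and self-similar solutions\<close>

definition rotation_z :: "real \<Rightarrow> real ^ 3 ^ 3" where
  "rotation_z \<theta> = vector [vector [cos \<theta>, - sin \<theta>, 0],
                          vector [sin \<theta>, cos \<theta>, 0],
                          vector [0, 0, 1]]"

definition vertical_translation :: "(real \<Rightarrow> real) \<Rightarrow> real \<Rightarrow> real ^ 3" where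
  "vertical_translation \<zeta> t = vector [0, 0, \<zeta> t]"

text \<open>
  The interval \<open>I\<close> must not be a single point, since derivatives are taken within \<open>I\<close>; they are
  one-sided at endpoints belonging to \<open>I\<close>.
\<close>

definition motion_data ::
    "real set \<Rightarrow> (real \<Rightarrow> real) \<Rightarrow> (real \<Rightarrow> real) \<Rightarrow> (real \<Rightarrow> real) \<Rightarrow> bool" where
  "motion_data I \<sigma> \<xi> \<zeta> \<longleftrightarrow>
     is_interval I \<and> 0 \<in> I \<and> I \<noteq> {0} \<and>
     (\<forall>t\<in>I. \<sigma> t > 0) \<and>
     \<sigma> differentiable_on I \<and> \<xi> differentiable_on I \<and> \<zeta> differentiable_on I \<and>
     \<sigma> 0 = 1 \<and> \<xi> 0 = 0 \<and> \<zeta> 0 = 0"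

definition motion ::
    "(real \<Rightarrow> real) \<Rightarrow> (real \<Rightarrow> real) \<Rightarrow> (real \<Rightarrow> real) \<Rightarrow> real \<Rightarrow> real ^ 3 \<Rightarrow> real ^ 3" where
  "motion \<sigma> \<xi> \<zeta> t x = \<sigma> t *\<^sub>R (rotation_z (\<xi> t) *v x) + vertical_translation \<zeta> t"

definition homothetic_helicoidal_motion ::
    "real set \<Rightarrow> (real \<Rightarrow> real ^ 3 \<Rightarrow> real ^ 3) \<Rightarrow> real \<Rightarrow> real \<Rightarrow> bool" where
  \<comment> \<open>the last two arguments are the dilation and translation rates\<close>
  "homothetic_helicoidal_motion I L c b \<longleftrightarrow>
     (\<exists>\<sigma> \<xi> \<zeta>. motion_data I \<sigma> \<xi> \<zeta> \<and> L = motion \<sigma> \<xi> \<zeta> \<and>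
        (\<sigma> has_real_derivative c) (at 0 within I) \<and>
        (vertical_translation \<zeta> has_vector_derivative b *\<^sub>R e3) (at 0 within I))"

text \<open>
  Changing the sign of the unit normal changes the sign of both sides of the equation, so the
  condition does not depend on the choice of the unit normal at each time.
\<close>

definition self_similar_solution ::
    "real set \<Rightarrow> (real \<times> real) set \<Rightarrow> (real \<Rightarrow> real \<times> real \<Rightarrow> real ^ 3) \<Rightarrow> bool" where
  "self_similar_solution I U Xt \<longleftrightarrow>
     (\<forall>t\<in>I. \<exists>N. unit_normal_on U (Xt t) N \<and>
        (\<forall>p\<in>U. vector_derivative (\<lambda>r. Xt r p) (at t within I) \<bullet> N p
                 = mean_curvature (Xt t) N p))"

definition mcf_initial_datum ::
    "(real \<times> real) set \<Rightarrow> (real \<times> real \<Rightarrow> real ^ 3) \<Rightarrow> real \<Rightarrow> real \<Rightarrow> bool" where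
  "mcf_initial_datum U X c b \<longleftrightarrow>
     (\<exists>I L. homothetic_helicoidal_motion I L c b \<and>
        (\<forall>p\<in>U. L 0 (X p) = X p) \<and>
        self_similar_solution I U (\<lambda>t p. L t (X p)))"

end

theory Submission
  imports Defs
begin

text \<open>
  A homothetic helicoidal motion carries a surface of revolution \<open>X\<close> with profile
  \<open>(\<phi>, \<psi>)\<close> to the surface of revolution with profile \<open>(\<sigma> \<phi>, \<sigma> \<psi> + \<zeta>)\<close>,
  up to a shift of the angle \<open>u\<close> by \<open>\<xi>\<close>. The angular part of the velocity is
  tangent to it, so the rotation contributes nothing to the normal speed. Write \<open>\<tau>\<close> for the
  profile tangent, \<open>\<eta>\<close> for the profile normal and \<open>\<kappa>\<close> for the profile curvature, and
  take the unit normal obtained by rotating \<open>\<eta> / |\<tau>|\<close>. At time \<open>t\<close> the normal speed is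
  \<open>(\<sigma>' \<langle>\<alpha>, \<eta>\<rangle> + \<zeta>' \<langle>e3, \<eta>\<rangle>) / |\<tau>|\<close>,
  while the two principal curvatures of \<open>X\<close>, divided by the scale \<open>\<sigma>\<close>, give the mean curvature
  \<open>(\<kappa> - \<langle>e3, \<tau>\<rangle> / (\<phi> |\<tau>|)) / (2 \<sigma>)\<close>. Equating the two and multiplying
  by \<open>2 \<sigma>\<close> turns the flow equation at time \<open>t\<close> into the asserted formula for
  \<open>\<kappa>\<close> with \<open>\<sigma> \<sigma>'\<close> in place of \<open>c\<close> and \<open>\<sigma> \<zeta>'\<close> in place of \<open>b\<close>;
  this is \<open>flow_equation_iff\<close>.

  Necessity is the case \<open>t = 0\<close>, where \<open>\<sigma> = 1\<close>. For sufficiency the motion must keep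
  the products \<open>\<sigma> \<sigma>'\<close> and \<open>\<sigma> \<zeta>'\<close> constant, so that the equations for all
  times are one and the same; \<open>motion_with_constant_rates_exists\<close> solves these two differential
  equations with \<open>\<sigma>(t) = sqrt (1 + 2 c t)\<close> and no rotation.

  All computations take place in the orthonormal cylindrical frame at the relevant angle, in which
  the vectors involved have components that do not depend on the angle.
\<close>

section \<open>Vectors in cylindrical components\<close>

text \<open>
  Radial, angular and vertical components, in this order, with respect to the cylindrical frame at
  angle \<open>u\<close>.
\<close>

definition cyl :: "real \<Rightarrow> real \<Rightarrow> real \<Rightarrow> real \<Rightarrow> real ^ 3" where
  "cyl r w z u = vector [r * cos u - w * sin u, r * sin u + w * cos u, z]"

lemma cyl_eq_axis_sum:
  "cyl r w z u = (r * cos u - w * sin u) *\<^sub>R axis 1 1 + (r * sin u + w * cos u) *\<^sub>R axis 2 1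
     + z *\<^sub>R axis 3 1"
  by (simp add: cyl_def vec_eq_iff forall_3 axis_def)

lemma inner_cyl: "cyl r w z u \<bullet> cyl r' w' z' u = r * r' + w * w' + z * z'"
proof -
  have "cyl r w z u \<bullet> cyl r' w' z' u = (r * r' + w * w') * ((cos u)\<^sup>2 + (sin u)\<^sup>2) + z * z'"
    unfolding cyl_def inner_vec_def sum_3 vector_3 inner_real_def power2_eq_square
    by algebra
  then show ?thesis by simp
qed

lemma cyl_surj:
  obtains r w z where "v = cyl r w z u"
proof
  have sq: "sin u * sin u = 1 - cos u * cos u"
    by (simp add: algebra_simps flip: power2_eq_square)
  have 1: "v $ 1 = (v$1 * cos u + v$2 * sin u) * cos u - (v$2 * cos u - v$1 * sin u) * sin u"
    using sq by algebra
  have 2: "v $ 2 = (v$1 * cos u + v$2 * sin u) * sin u + (v$2 * cos u - v$1 * sin u) * cos u"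
    using sq by algebra
  show "v = cyl (v$1 * cos u + v$2 * sin u) (v$2 * cos u - v$1 * sin u) (v$3) u"
    unfolding cyl_def vec_eq_iff forall_3 vector_3 using 1 2 by simp
qed

text \<open>
  The frame itself turns when the angle moves: its radial vector has the angular one as derivative,
  and the angular one has minus the radial one. This accounts for the terms in \<open>u'\<close>.
\<close>

lemma has_vector_derivative_cyl:
  assumes "(r has_real_derivative r') (at x within A)" "(w has_real_derivative w') (at x within A)"
    "(z has_real_derivative z') (at x within A)" "(u has_real_derivative u') (at x within A)"
  shows "((\<lambda>x. cyl (r x) (w x) (z x) (u x)) has_vector_derivative
           cyl (r' - w x * u') (w' + r x * u') z' (u x)) (at x within A)"
  unfolding cyl_eq_axis_sum
  by (rule derivative_eq_intros assms refl)+
     (simp add: algebra_simps)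

lemma continuous_on_cyl:
  fixes A :: "'a::t2_space set"
  assumes "continuous_on A r" "continuous_on A w" "continuous_on A z" "continuous_on A u"
  shows "continuous_on A (\<lambda>x. cyl (r x) (w x) (z x) (u x))"
  unfolding cyl_eq_axis_sum by (intro continuous_intros assms)

lemma surface_of_revolution_eq_cyl:
  "surface_of_revolution \<phi> \<psi> (u, s) = cyl (\<phi> s) 0 (\<psi> s) u"
  by (simp add: surface_of_revolution_def cyl_def)

text \<open>
  The moved surface is again rotational about the same axis. This is why one computation, for an
  arbitrary profile and an arbitrary shift of the angle, covers all times.
\<close>

lemma motion_surface_of_revolution:
  "motion \<sigma> \<xi> \<zeta> t (surface_of_revolution \<phi> \<psi> (u, s)) =
     cyl (\<sigma> t * \<phi> s) 0 (\<sigma> t * \<psi> s + \<zeta> t) (u + \<xi> t)"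
  by (simp add: motion_def surface_of_revolution_eq_cyl cyl_def vec_eq_iff forall_3
      rotation_z_def vertical_translation_def matrix_vector_mult_def sum_3 cos_add sin_add
      algebra_simps)

lemma smooth_on_derivs:
  assumes "smooth_on S f" "s \<in> S"
  shows "(f has_real_derivative deriv f s) (at s)"
    and "(deriv f has_real_derivative deriv (deriv f) s) (at s)"
proof -
  have "(deriv ^^ 0) f differentiable (at s)" "(deriv ^^ 1) f differentiable (at s)"
    using assms unfolding smooth_on_def by blast+
  then show "(f has_real_derivative deriv f s) (at s)"
    "(deriv f has_real_derivative deriv (deriv f) s) (at s)"
    by (simp_all add: DERIV_deriv_iff_real_differentiable)
qed

section \<open>Geometry of rotational surfaces\<close>

text \<open>
  Vector fields with components independent of the angle are closed under both partial derivatives,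
  so the following two rules can be iterated to get the second derivatives of the surface. The
  angular component \<open>w\<close> occurs because differentiation in \<open>u\<close> turns a radial field into an
  angular one.
\<close>

lemma pd1_rotational:
  assumes "\<And>u s. Y (u, s) = cyl (\<Phi> s) (w s) (\<Psi> s) (u + \<theta>)"
  shows "pd1 Y (u, s) = cyl (- w s) (\<Phi> s) 0 (u + \<theta>)"
proof -
  have "((\<lambda>v. cyl (\<Phi> s) (w s) (\<Psi> s) (v + \<theta>)) has_vector_derivative
      cyl (0 - w s * 1) (0 + \<Phi> s * 1) 0 (u + \<theta>)) (at u)"
    by (rule has_vector_derivative_cyl) (auto intro!: derivative_eq_intros)
  then show ?thesis
    by (simp add: pd1_def assms vector_derivative_at)
qed

lemma pd2_rotational:
  assumes "\<forall>\<^sub>F v in nhds s. Y (u, v) = cyl (\<Phi> v) (w v) (\<Psi> v) (u + \<theta>)"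
    and "(\<Phi> has_real_derivative \<Phi>') (at s)" "(w has_real_derivative w') (at s)"
    and "(\<Psi> has_real_derivative \<Psi>') (at s)"
  shows "pd2 Y (u, s) = cyl \<Phi>' w' \<Psi>' (u + \<theta>)"
proof -
  have "((\<lambda>v. cyl (\<Phi> v) (w v) (\<Psi> v) (u + \<theta>)) has_vector_derivative
      cyl (\<Phi>' - w s * 0) (w' + \<Phi> s * 0) \<Psi>' (u + \<theta>)) (at s)"
    by (rule has_vector_derivative_cyl) (use assms in auto)
  moreover have "vector_derivative (\<lambda>v. Y (u, v)) (at s) =
      vector_derivative (\<lambda>v. cyl (\<Phi> v) (w v) (\<Psi> v) (u + \<theta>)) (at s)"
    by (rule vector_derivative_cong_eq) (use assms(1) in auto)
  ultimately show ?thesis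
    by (simp add: pd2_def vector_derivative_at)
qed

text \<open>
  The coordinates are orthogonal (\<open>F = 0\<close>), so the mixed coefficient \<open>f\<close> drops out. The two
  terms of the numerator come from the normal curvature of the meridian (second derivatives of the
  profile) and that of the parallel (no second derivatives). The components of \<open>N\<close> are
  left free because the mean curvature is linear in them.
\<close>

lemma rotational_surface_geometry:
  assumes Y: "\<And>u s. Y (u, s) = cyl (\<Phi> s) 0 (\<Psi> s) (u + \<theta>)"
    and S: "open S" "s \<in> S"
    and d1: "\<forall>v\<in>S. (\<Phi> has_real_derivative \<Phi>1 v) (at v)"
      "\<forall>v\<in>S. (\<Psi> has_real_derivative \<Psi>1 v) (at v)"
    and d2: "(\<Phi>1 has_real_derivative \<Phi>2) (at s)" "(\<Psi>1 has_real_derivative \<Psi>2) (at s)"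
  shows pd1_rotational_surface: "pd1 Y (u, s) = cyl 0 (\<Phi> s) 0 (u + \<theta>)"
    and pd2_rotational_surface: "pd2 Y (u, s) = cyl (\<Phi>1 s) 0 (\<Psi>1 s) (u + \<theta>)"
    and mean_curvature_rotational_surface:
      "N (u, s) = cyl x y z (u + \<theta>) \<Longrightarrow> mean_curvature Y N (u, s) =
      ((\<Phi> s)\<^sup>2 * (x * \<Phi>2 + z * \<Psi>2) - ((\<Phi>1 s)\<^sup>2 + (\<Psi>1 s)\<^sup>2) * \<Phi> s * x) /
      (2 * ((\<Phi> s)\<^sup>2 * ((\<Phi>1 s)\<^sup>2 + (\<Psi>1 s)\<^sup>2)))"
proof -
  have Y1: "pd1 Y (u, v) = cyl 0 (\<Phi> v) 0 (u + \<theta>)" for u v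
    using pd1_rotational[of Y \<Phi> "\<lambda>_. 0" \<Psi> \<theta>] Y by simp
  have Y2: "pd2 Y (u, v) = cyl (\<Phi>1 v) 0 (\<Psi>1 v) (u + \<theta>)" if "v \<in> S" for u v
    by (rule pd2_rotational[where w = "\<lambda>_. 0"]) (use that Y d1 in auto)
  show "pd1 Y (u, s) = cyl 0 (\<Phi> s) 0 (u + \<theta>)"
    and "pd2 Y (u, s) = cyl (\<Phi>1 s) 0 (\<Psi>1 s) (u + \<theta>)"
    by (simp_all add: Y1 Y2 S)
  have Y11: "pd1 (pd1 Y) (u, s) = cyl (- \<Phi> s) 0 0 (u + \<theta>)"
    using pd1_rotational[of "pd1 Y" "\<lambda>_. 0" \<Phi> "\<lambda>_. 0" \<theta>] Y1 by simp
  have Y22: "pd2 (pd2 Y) (u, s) = cyl \<Phi>2 0 \<Psi>2 (u + \<theta>)"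
  proof (rule pd2_rotational[where w = "\<lambda>_. 0"])
    show "\<forall>\<^sub>F v in nhds s. pd2 Y (u, v) = cyl (\<Phi>1 v) 0 (\<Psi>1 v) (u + \<theta>)"
      using eventually_nhds_in_open[OF S] by eventually_elim (simp add: Y2)
  qed (use d2 in auto)
  show "mean_curvature Y N (u, s) =
      ((\<Phi> s)\<^sup>2 * (x * \<Phi>2 + z * \<Psi>2) - ((\<Phi>1 s)\<^sup>2 + (\<Psi>1 s)\<^sup>2) * \<Phi> s * x) /
      (2 * ((\<Phi> s)\<^sup>2 * ((\<Phi>1 s)\<^sup>2 + (\<Psi>1 s)\<^sup>2)))" if N: "N (u, s) = cyl x y z (u + \<theta>)"
    unfolding mean_curvature_def Let_def Y1 Y2[OF S(2)] Y11 Y22 N inner_cyl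
    by (simp add: power2_eq_square algebra_simps)
qed

text \<open>
  Orthogonality to the parallel kills the angular component and orthogonality to the meridian
  \<open>(p, q)\<close> fixes the direction in the meridian plane. The factor \<open>k\<close> is one over the length of
  \<open>(p, q)\<close>, up to sign; but both sides of the flow equation are linear in \<open>N\<close>, so there
  it only has to be cancelled.
\<close>

lemma unit_normal_multiple_of_profile_normal:
  assumes "norm (cyl x y z u) = 1" "cyl x y z u \<bullet> cyl 0 r 0 u = 0" "cyl x y z u \<bullet> cyl p 0 q u = 0"
    and "r \<noteq> 0" "p\<^sup>2 + q\<^sup>2 \<noteq> 0"
  obtains k where "k \<noteq> 0" "x = k * q" "z = - k * p"
proof
  define k where "k = (x * q - z * p) / (p\<^sup>2 + q\<^sup>2)"
  have "y = 0" and perp: "x * p + z * q = 0"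
    using assms by (simp_all add: inner_cyl)
  have "x * (p\<^sup>2 + q\<^sup>2) = (x * q - z * p) * q" "z * (p\<^sup>2 + q\<^sup>2) = - (x * q - z * p) * p"
    using perp by algebra+
  then show xz: "x = k * q" "z = - k * p"
    using assms(5) by (simp_all add: k_def field_simps)
  show "k \<noteq> 0"
  proof
    assume "k = 0"
    then have "cyl x y z u = 0" using xz \<open>y = 0\<close> by (simp add: cyl_def vec_eq_iff forall_3)
    then show False using assms(1) by simp
  qed
qed

text \<open>
  The injective differential cannot send a coordinate vector to zero, and the two images are the
  tangent vectors of the parallel, of length \<open>|\<phi> s|\<close>, and of the meridian, of squared length
  \<open>\<phi>'\<^sup>2 + \<psi>'\<^sup>2\<close>.
\<close>

lemma immersion_surface_of_revolutionD:
  assumes imm: "immersion_on U (surface_of_revolution \<phi> \<psi>)" and p: "(u, s) \<in> U"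
    and d: "(\<phi> has_real_derivative \<phi>') (at s)" "(\<psi> has_real_derivative \<psi>') (at s)"
  shows "\<phi> s \<noteq> 0" and "\<phi>'\<^sup>2 + \<psi>'\<^sup>2 \<noteq> 0"
proof -
  let ?X = "surface_of_revolution \<phi> \<psi>"
  obtain D where D: "(?X has_derivative D) (at (u, s))" and "inj D"
    using imm p unfolding immersion_on_def by blast
  have lin: "linear D" using D by (rule has_derivative_linear)
  then have nz: "D v \<noteq> 0" if "v \<noteq> 0" for v
    using \<open>inj D\<close> that linear_injective_0 by blast
  have 0: "cyl 0 0 0 u = 0" by (simp add: cyl_def vec_eq_iff forall_3)
  have "((\<lambda>v. (v, s)) has_vector_derivative (1, 0)) (at u)"
    "((\<lambda>v. (u, v)) has_vector_derivative (0, 1)) (at s)"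
    by (auto intro!: derivative_eq_intros has_vector_derivative_Pair)
  then have "((\<lambda>v. ?X (v, s)) has_vector_derivative D (1, 0)) (at u)"
    and "((\<lambda>v. ?X (u, v)) has_vector_derivative D (0, 1)) (at s)"
    using vector_derivative_diff_chain_within[of _ _ _ UNIV ?X D] has_derivative_at_withinI[OF D]
    unfolding o_def by blast+
  moreover have "((\<lambda>v. cyl (\<phi> s) 0 (\<psi> s) v) has_vector_derivative
      cyl (0 - 0 * 1) (0 + \<phi> s * 1) 0 u) (at u)"
    by (rule has_vector_derivative_cyl) (auto intro!: derivative_eq_intros)
  moreover have "((\<lambda>v. cyl (\<phi> v) 0 (\<psi> v) u) has_vector_derivative
      cyl (\<phi>' - 0 * 0) (0 + \<phi> s * 0) \<psi>' u) (at s)"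
    by (rule has_vector_derivative_cyl) (use d in auto)
  ultimately have "D (1, 0) = cyl 0 (\<phi> s) 0 u" "D (0, 1) = cyl \<phi>' 0 \<psi>' u"
    by (auto simp: surface_of_revolution_eq_cyl intro: vector_derivative_unique_at)
  then show "\<phi> s \<noteq> 0" "\<phi>'\<^sup>2 + \<psi>'\<^sup>2 \<noteq> 0"
    using nz[of "(1, 0)"] nz[of "(0, 1)"] 0 by (auto simp: zero_prod_def)
qed

text \<open>
  The rotated profile normal, normalized, serves at every time: neither the scaling nor the
  translation changes its direction.
\<close>

lemma unit_normal_rotational_exists:
  assumes U: "open U" and smooth: "smooth_on (snd ` U) \<phi>" "smooth_on (snd ` U) \<psi>"
    and imm: "immersion_on U (surface_of_revolution \<phi> \<psi>)"
    and m: "\<sigma> t > 0"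
  obtains N where "unit_normal_on U (\<lambda>p. motion \<sigma> \<xi> \<zeta> t (surface_of_revolution \<phi> \<psi> p)) N"
proof
  let ?W = "\<lambda>s. sqrt ((deriv \<phi> s)\<^sup>2 + (deriv \<psi> s)\<^sup>2)"
  let ?Y = "\<lambda>p. motion \<sigma> \<xi> \<zeta> t (surface_of_revolution \<phi> \<psi> p)"
  define N where "N = (\<lambda>p. cyl (deriv \<psi> (snd p) / ?W (snd p)) 0 (- deriv \<phi> (snd p) / ?W (snd p)) (fst p + \<xi> t))"
  have S: "open (snd ` U)" using U by (rule open_image_snd)
  note d = smooth_on_derivs[OF smooth(1)] smooth_on_derivs[OF smooth(2)]
  have nz: "(deriv \<phi> (snd p))\<^sup>2 + (deriv \<psi> (snd p))\<^sup>2 \<noteq> 0" if "p \<in> U" for p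
    using immersion_surface_of_revolutionD(2)[OF imm, of "fst p" "snd p", OF _ d(1,3)] that by auto
  have "continuous_on (snd ` U) (deriv \<phi>)" "continuous_on (snd ` U) (deriv \<psi>)"
    using d by (meson DERIV_isCont continuous_at_imp_continuous_on)+
  then have cont: "continuous_on U (\<lambda>p. deriv \<phi> (snd p))" "continuous_on U (\<lambda>p. deriv \<psi> (snd p))"
    by (auto intro: continuous_on_compose2[OF _ continuous_on_snd[OF continuous_on_id]])
  show "unit_normal_on U ?Y N"
    unfolding unit_normal_on_def
  proof (intro conjI ballI)
    show "continuous_on U N"
      unfolding N_def by (intro continuous_on_cyl continuous_intros cont) (use nz in auto)
    fix p assume p: "p \<in> U"
    obtain u s where [simp]: "p = (u, s)" by (cases p)
    have s: "s \<in> snd ` U" using p by force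
    have "\<forall>v\<in>snd ` U. ((\<lambda>v. \<sigma> t * \<phi> v) has_real_derivative \<sigma> t * deriv \<phi> v) (at v)"
      "\<forall>v\<in>snd ` U. ((\<lambda>v. \<sigma> t * \<psi> v + \<zeta> t) has_real_derivative \<sigma> t * deriv \<psi> v) (at v)"
      "((\<lambda>v. \<sigma> t * deriv \<phi> v) has_real_derivative \<sigma> t * deriv (deriv \<phi>) s) (at s)"
      "((\<lambda>v. \<sigma> t * deriv \<psi> v) has_real_derivative \<sigma> t * deriv (deriv \<psi>) s) (at s)"
      using d(2,4)[OF s] d(1,3) by (auto intro!: derivative_eq_intros)
    note pd = rotational_surface_geometry(1,2)[where Y = ?Y and \<theta> = "\<xi> t",
        OF motion_surface_of_revolution S s this]
    show "N p \<bullet> pd1 ?Y p = 0" "N p \<bullet> pd2 ?Y p = 0"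
      using pd by (simp_all add: N_def inner_cyl)
    have "(deriv \<psi> s / ?W s)\<^sup>2 + (- deriv \<phi> s / ?W s)\<^sup>2 = 1"
      using nz[OF p] by (simp add: power_divide add_divide_distrib[symmetric] add.commute)
    then show "norm (N p) = 1"
      by (simp add: N_def norm_eq_sqrt_inner inner_cyl power2_eq_square)
  qed
qed

section \<open>The flow equation at a fixed time\<close>

text \<open>
  Only the components of the velocity in the meridian plane meet the normal, so the rotation rate
  \<open>\<xi>'\<close> disappears. The scale enters the profile and its derivatives linearly: the normal
  speed acquires no factor, the curvature a factor \<open>1 / \<sigma>\<close>, which is moved to the other side.
\<close>

lemma flow_equation_iff:
  assumes S: "open S" "s \<in> S" and smooth: "smooth_on S \<phi>" "smooth_on S \<psi>"
    and reg: "\<phi> s \<noteq> 0" "(deriv \<phi> s)\<^sup>2 + (deriv \<psi> s)\<^sup>2 \<noteq> 0"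
    and pos: "\<sigma> t > 0"
    and der: "(\<sigma> has_real_derivative \<sigma>') (at t within I)" "(\<xi> has_real_derivative \<xi>') (at t within I)"
      "(\<zeta> has_real_derivative \<zeta>') (at t within I)"
    and lim: "t islimpt I"
  defines "Y \<equiv> \<lambda>r p. motion \<sigma> \<xi> \<zeta> r (surface_of_revolution \<phi> \<psi> p)"
  assumes N: "norm (N (u, s)) = 1" "N (u, s) \<bullet> pd1 (Y t) (u, s) = 0" "N (u, s) \<bullet> pd2 (Y t) (u, s) = 0"
  shows "vector_derivative (\<lambda>r. Y r (u, s)) (at t within I) \<bullet> N (u, s) = mean_curvature (Y t) N (u, s)
    \<longleftrightarrow> profile_curvature \<phi> \<psi> s =
         1 / norm (profile_tangent \<phi> \<psi> s) *
         (2 * (\<sigma> t * \<sigma>') * (profile_curve \<phi> \<psi> s \<bullet> profile_normal \<phi> \<psi> s)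
          + 2 * (\<sigma> t * \<zeta>') * (e3 \<bullet> profile_normal \<phi> \<psi> s)
          + 1 / \<phi> s * (e3 \<bullet> profile_tangent \<phi> \<psi> s))"
proof -
  define f g f1 g1 f2 g2 m where "f = \<phi> s" "g = \<psi> s" "f1 = deriv \<phi> s" "g1 = deriv \<psi> s"
    "f2 = deriv (deriv \<phi>) s" "g2 = deriv (deriv \<psi>) s" "m = \<sigma> t"
  note abbr = this
  have d\<phi>: "(\<phi> has_real_derivative deriv \<phi> v) (at v)"
    and d\<psi>: "(\<psi> has_real_derivative deriv \<psi> v) (at v)" if "v \<in> S" for v
    using smooth_on_derivs that smooth by blast+
  have dd: "(deriv \<phi> has_real_derivative f2) (at s)" "(deriv \<psi> has_real_derivative g2) (at s)"
    using smooth_on_derivs S smooth unfolding abbr by blast+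
  have Y: "Y r (u, v) = cyl (\<sigma> r * \<phi> v) 0 (\<sigma> r * \<psi> v + \<zeta> r) (u + \<xi> r)" for r u v
    by (simp add: Y_def motion_surface_of_revolution)
  have "((\<lambda>r. cyl (\<sigma> r * f) 0 (\<sigma> r * g + \<zeta> r) (u + \<xi> r)) has_vector_derivative
      cyl (\<sigma>' * f - 0 * \<xi>') (0 + (\<sigma> t * f) * \<xi>') (\<sigma>' * g + \<zeta>') (u + \<xi> t)) (at t within I)"
    by (rule has_vector_derivative_cyl) (auto intro!: derivative_eq_intros der)
  then have velocity: "vector_derivative (\<lambda>r. Y r (u, s)) (at t within I) =
      cyl (\<sigma>' * f) (m * f * \<xi>') (\<sigma>' * g + \<zeta>') (u + \<xi> t)"
    using lim by (simp add: Y abbr vector_derivative_within trivial_limit_within)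
  have profile: "\<forall>v\<in>S. ((\<lambda>v. m * \<phi> v) has_real_derivative m * deriv \<phi> v) (at v)"
    "\<forall>v\<in>S. ((\<lambda>v. m * \<psi> v + \<zeta> t) has_real_derivative m * deriv \<psi> v) (at v)"
    using d\<phi> d\<psi> by (auto intro!: derivative_eq_intros)
  have profile': "((\<lambda>v. m * deriv \<phi> v) has_real_derivative m * f2) (at s)"
    "((\<lambda>v. m * deriv \<psi> v) has_real_derivative m * g2) (at s)"
    using dd by (auto intro!: derivative_eq_intros)
  note geometry = rotational_surface_geometry[OF Y[of t, folded abbr(7)] S profile profile']
  have nz: "m \<noteq> 0" "f \<noteq> 0" "f1\<^sup>2 + g1\<^sup>2 \<noteq> 0"
    using pos reg by (auto simp: abbr)
  obtain x y z where xyz: "N (u, s) = cyl x y z (u + \<xi> t)"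
    by (rule cyl_surj)
  have perp: "norm (cyl x y z (u + \<xi> t)) = 1"
    "cyl x y z (u + \<xi> t) \<bullet> cyl 0 (m * f) 0 (u + \<xi> t) = 0"
    "cyl x y z (u + \<xi> t) \<bullet> cyl (m * f1) 0 (m * g1) (u + \<xi> t) = 0"
    using N geometry(1,2) by (simp_all add: xyz abbr)
  have "(m * f1)\<^sup>2 + (m * g1)\<^sup>2 = m\<^sup>2 * (f1\<^sup>2 + g1\<^sup>2)"
    by algebra
  then have nz': "m * f \<noteq> 0" "(m * f1)\<^sup>2 + (m * g1)\<^sup>2 \<noteq> 0"
    using nz by auto
  have y: "y = 0" using perp(2) nz by (simp add: inner_cyl)
  obtain k where k: "k \<noteq> 0" "x = k * (m * g1)" "z = - k * (m * f1)"
    using unit_normal_multiple_of_profile_normal[OF perp nz'] .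
  define W where "W = f1\<^sup>2 + g1\<^sup>2"
  have W: "W > 0" using nz unfolding W_def by (simp add: sum_power2_gt_zero_iff)
  have "mean_curvature (Y t) N (u, s) =
     ((m * f)\<^sup>2 * (x * (m * f2) + z * (m * g2)) - ((m * f1)\<^sup>2 + (m * g1)\<^sup>2) * (m * f) * x) /
      (2 * ((m * f)\<^sup>2 * ((m * f1)\<^sup>2 + (m * g1)\<^sup>2)))"
    using geometry(3)[where N = N, OF xyz] by (simp only: abbr)
  also have "\<dots> = k / 2 * ((f2 * g1 - g2 * f1) / W - g1 / f)"
  proof -
    have eq: "(m * f1)\<^sup>2 + (m * g1)\<^sup>2 = m\<^sup>2 * W" unfolding W_def by algebra
    have "(m * f)\<^sup>2 * (x * (m * f2) + z * (m * g2)) - m\<^sup>2 * W * (m * f) * x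
        = m\<^sup>2 * m\<^sup>2 * k * f * ((f2 * g1 - g2 * f1) * f - g1 * W)"
      unfolding k by algebra
    moreover have "(f2 * g1 - g2 * f1) / W - g1 / f = ((f2 * g1 - g2 * f1) * f - g1 * W) / (W * f)"
      using W nz by (simp add: diff_frac_eq)
    ultimately show ?thesis unfolding eq using W nz by (simp add: power2_eq_square)
  qed
  finally have H: "mean_curvature (Y t) N (u, s) = k / 2 * ((f2 * g1 - g2 * f1) / W - g1 / f)" .
  have V: "vector_derivative (\<lambda>r. Y r (u, s)) (at t within I) \<bullet> N (u, s)
      = k / 2 * (2 * (m * \<sigma>') * (f * g1 - g * f1) - 2 * (m * \<zeta>') * f1)"
    unfolding velocity xyz inner_cyl k y by (simp add: algebra_simps)
  have "((\<lambda>v. cyl 0 (\<phi> v) (\<psi> v) 0) has_vector_derivative cyl (0 - \<phi> s * 0) (f1 + 0 * 0) g1 0) (at s)"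
    by (rule has_vector_derivative_cyl) (use d\<phi> d\<psi> S in \<open>auto simp: abbr\<close>)
  then have tangent: "profile_tangent \<phi> \<psi> s = cyl 0 f1 g1 0"
    by (simp add: profile_tangent_def profile_curve_def[abs_def] cyl_def vector_derivative_at)
  have curve: "profile_curve \<phi> \<psi> s = cyl 0 f g 0" "profile_normal \<phi> \<psi> s = cyl 0 g1 (- f1) 0"
    "e3 = cyl 0 0 1 0"
    by (simp_all add: profile_curve_def profile_normal_def e3_def cyl_def abbr)
  have speed: "norm (profile_tangent \<phi> \<psi> s) = sqrt W"
    by (simp add: tangent norm_eq_sqrt_inner inner_cyl W_def power2_eq_square)
  \<comment> \<open>The exponent \<open>3 / 2\<close> is split so that the curvature formula carries the same factor
     \<open>1 / |\<tau>|\<close> as the right-hand side.\<close>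
  have "W powr (3 / 2) = W powr (1 + 1 / 2)" by simp
  also have "\<dots> = W * sqrt W"
    using W by (subst powr_add) (simp add: powr_half_sqrt)
  finally have curvature: "profile_curvature \<phi> \<psi> s = 1 / sqrt W * ((f2 * g1 - g2 * f1) / W)"
    by (simp add: profile_curvature_def W_def abbr)
  have "(vector_derivative (\<lambda>r. Y r (u, s)) (at t within I) \<bullet> N (u, s) = mean_curvature (Y t) N (u, s))
    \<longleftrightarrow> (f2 * g1 - g2 * f1) / W = 
      2 * (m * \<sigma>') * (f * g1 - g * f1) - 2 * (m * \<zeta>') * f1 + g1 / f"
    unfolding H V using k(1) by auto
  also have "\<dots> \<longleftrightarrow> profile_curvature \<phi> \<psi> s = 1 / sqrt W *
      (2 * (m * \<sigma>') * (f * g1 - g * f1) - 2 * (m * \<zeta>') * f1 + g1 / f)"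
    unfolding curvature mult_cancel_left using W by simp
  finally show ?thesis
    unfolding speed unfolding tangent curve inner_cyl by (simp add: abbr)
qed

section \<open>Existence of the motion\<close>

text \<open>
  The equation \<open>\<sigma> \<sigma>' = c\<close> says that \<open>\<sigma>\<^sup>2\<close> has constant derivative
  \<open>2 c\<close>. Integrating \<open>\<zeta>' = b / \<sigma>\<close> gives \<open>b (\<sigma> - 1) / c\<close>, which is
  rewritten with \<open>\<sigma>\<^sup>2 - 1 = 2 c t\<close> as \<open>2 b t / (1 + \<sigma>)\<close> to cover the translating
  case \<open>c = 0\<close> as well.
\<close>

lemma motion_with_constant_rates_exists:
  fixes b c :: real
  obtains I \<sigma> \<zeta> where "motion_data I \<sigma> (\<lambda>_. 0) \<zeta>"
    and "\<forall>t\<in>I. (\<sigma> has_real_derivative c / \<sigma> t) (at t within I)"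
    and "\<forall>t\<in>I. (\<zeta> has_real_derivative b / \<sigma> t) (at t within I)"
proof -
  \<comment> \<open>The radius is chosen so that \<open>|2 c t| < 1\<close>; adding one to \<open>|c|\<close> keeps it finite for \<open>c = 0\<close>.\<close>
  define I where "I = ball (0::real) (1 / (2 * (\<bar>c\<bar> + 1)))"
  define \<sigma> where "\<sigma> = (\<lambda>t. sqrt (1 + 2 * c * t))"
  define \<zeta> where "\<zeta> = (\<lambda>t. 2 * b * t / (1 + \<sigma> t))"
  have radicand: "1 + 2 * c * t > 0" if "t \<in> I" for t
  proof -
    have "\<bar>2 * c * t\<bar> = 2 * \<bar>c\<bar> * \<bar>t\<bar>" by (simp add: abs_mult)
    also have "\<dots> \<le> 2 * \<bar>c\<bar> * (1 / (2 * (\<bar>c\<bar> + 1)))"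
      using that by (intro mult_left_mono) (auto simp: I_def)
    also have "\<dots> < 1" by (simp add: field_simps)
    finally show ?thesis by linarith
  qed
  have \<sigma>_pos: "\<sigma> t > 0" if "t \<in> I" for t
    using radicand[OF that] by (simp add: \<sigma>_def)
  have \<sigma>': "(\<sigma> has_real_derivative c / \<sigma> t) (at t within I)" if "t \<in> I" for t
    unfolding \<sigma>_def using radicand[OF that]
    by (auto intro!: derivative_eq_intros simp: field_simps)
  have \<zeta>': "(\<zeta> has_real_derivative b / \<sigma> t) (at t within I)" if t: "t \<in> I" for t
  proof -
    have "(\<zeta> has_real_derivative
        ((2 * b) * (1 + \<sigma> t) - (2 * b * t) * (c / \<sigma> t)) / ((1 + \<sigma> t) * (1 + \<sigma> t))) (at t within I)"
      unfolding \<zeta>_def using \<sigma>_pos[OF t]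
      by (auto intro!: derivative_eq_intros \<sigma>' t)
    moreover have "((2 * b) * (1 + \<sigma> t) - (2 * b * t) * (c / \<sigma> t)) / ((1 + \<sigma> t) * (1 + \<sigma> t)) = b / \<sigma> t"
    proof -
      have sq: "2 * c * t = \<sigma> t * \<sigma> t - 1"
        using radicand[OF t] by (simp add: \<sigma>_def)
      have "(2 * b) * (1 + \<sigma> t) - (2 * b * t) * (c / \<sigma> t) = b / \<sigma> t * (2 * \<sigma> t * (1 + \<sigma> t) - 2 * c * t)"
        using \<sigma>_pos[OF t] by (simp add: field_simps)
      also have "\<dots> = b / \<sigma> t * ((1 + \<sigma> t) * (1 + \<sigma> t))"
        unfolding sq by (simp add: algebra_simps)
      finally show ?thesis using \<sigma>_pos[OF t] by simp
    qed
    ultimately show ?thesis by simp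
  qed
  have "I \<noteq> {0}"
  proof
    assume "I = {0}"
    moreover have "1 / (4 * (\<bar>c\<bar> + 1)) \<in> I" by (simp add: I_def field_simps)
    ultimately show False by simp
  qed
  moreover have "is_interval I" "0 \<in> I" by (auto simp: I_def is_interval_ball_real)
  ultimately have "motion_data I \<sigma> (\<lambda>_. 0) \<zeta>"
    unfolding motion_data_def differentiable_on_def
    using \<sigma>_pos \<sigma>' \<zeta>' by (auto simp: \<zeta>_def \<sigma>_def real_differentiable_def)
  then show ?thesis using \<sigma>' \<zeta>' that by blast
qed

section \<open>Initial data of self-similar solutions\<close>

theorem theorem2:
  fixes U :: "(real \<times> real) set"
    and \<phi> \<psi> :: "real \<Rightarrow> real"
    and b c :: real
  assumes "open U"
    and "smooth_on (snd ` U) \<phi>"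
    and "smooth_on (snd ` U) \<psi>"
    and "immersion_on U (surface_of_revolution \<phi> \<psi>)"
  shows "mcf_initial_datum U (surface_of_revolution \<phi> \<psi>) c b \<longleftrightarrow>
    (\<forall>s\<in>snd ` U.
       profile_curvature \<phi> \<psi> s =
         1 / norm (profile_tangent \<phi> \<psi> s) *
         (2 * c * (profile_curve \<phi> \<psi> s \<bullet> profile_normal \<phi> \<psi> s)
          + 2 * b * (e3 \<bullet> profile_normal \<phi> \<psi> s)
          + 1 / \<phi> s * (e3 \<bullet> profile_tangent \<phi> \<psi> s)))"
    (is "?flow \<longleftrightarrow> (\<forall>s\<in>snd ` U. ?curvature s)")
proof -
  let ?X = "surface_of_revolution \<phi> \<psi>"
  have S: "open (snd ` U)" using assms(1) by (rule open_image_snd)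
  have reg: "\<phi> s \<noteq> 0" "(deriv \<phi> s)\<^sup>2 + (deriv \<psi> s)\<^sup>2 \<noteq> 0" if "(u, s) \<in> U" for u s
  proof -
    have "s \<in> snd ` U" using that by force
    then show "\<phi> s \<noteq> 0" "(deriv \<phi> s)\<^sup>2 + (deriv \<psi> s)\<^sup>2 \<noteq> 0"
      using immersion_surface_of_revolutionD[OF assms(4) that] smooth_on_derivs(1) assms(2,3)
      by blast+
  qed
  have lim: "t islimpt I" if "motion_data I \<sigma> \<xi> \<zeta>" "t \<in> I" for I \<sigma> \<xi> \<zeta> t
    using that connected_imp_perfect[of I t] unfolding motion_data_def is_interval_connected_1 by blast
  \<comment> \<open>Whenever the products of the scale with the two rates are \<open>c\<close> and \<open>b\<close>, the flow equation
     does not involve the time.\<close>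
  have key: "(vector_derivative (\<lambda>r. motion \<sigma> \<xi> \<zeta> r (?X (u, s))) (at t within I) \<bullet> N (u, s)
      = mean_curvature (\<lambda>p. motion \<sigma> \<xi> \<zeta> t (?X p)) N (u, s)) \<longleftrightarrow> ?curvature s"
    if data: "motion_data I \<sigma> \<xi> \<zeta>" "t \<in> I" and p: "(u, s) \<in> U"
      and der: "(\<sigma> has_real_derivative \<sigma>') (at t within I)" "(\<zeta> has_real_derivative \<zeta>') (at t within I)"
      and rates: "\<sigma> t * \<sigma>' = c" "\<sigma> t * \<zeta>' = b"
      and N: "unit_normal_on U (\<lambda>p. motion \<sigma> \<xi> \<zeta> t (?X p)) N"
    for I \<sigma> \<xi> \<zeta> t u s \<sigma>' \<zeta>' N
  proof -
    obtain \<xi>' where \<xi>': "(\<xi> has_real_derivative \<xi>') (at t within I)"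
      using data unfolding motion_data_def differentiable_on_def real_differentiable_def by blast
    have "s \<in> snd ` U" "\<sigma> t > 0"
      using data p by (force simp: motion_data_def)+
    from flow_equation_iff[OF S this(1) assms(2,3) reg[OF p] this(2) der(1) \<xi>' der(2) lim[OF data]]
    show ?thesis
      using N p unfolding unit_normal_on_def rates by blast
  qed
  show ?thesis
  proof
    assume ?flow
    then obtain I \<sigma> \<xi> \<zeta> where data: "motion_data I \<sigma> \<xi> \<zeta>"
      and \<sigma>': "(\<sigma> has_real_derivative c) (at 0 within I)"
      and trans: "(vertical_translation \<zeta> has_vector_derivative b *\<^sub>R e3) (at 0 within I)"
      and sol: "self_similar_solution I U (\<lambda>t p. motion \<sigma> \<xi> \<zeta> t (?X p))"
      unfolding mcf_initial_datum_def homothetic_helicoidal_motion_def by blast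
    have "((\<lambda>t. vertical_translation \<zeta> t $ 3) has_vector_derivative (b *\<^sub>R e3) $ 3) (at 0 within I)"
      using bounded_linear.has_vector_derivative[OF bounded_linear_vec_nth trans] .
    then have \<zeta>': "(\<zeta> has_real_derivative b) (at 0 within I)"
      by (simp add: vertical_translation_def e3_def has_real_derivative_iff_has_vector_derivative)
    have "0 \<in> I" "\<sigma> 0 = 1" using data by (auto simp: motion_data_def)
    then obtain N where N: "unit_normal_on U (\<lambda>p. motion \<sigma> \<xi> \<zeta> 0 (?X p)) N"
      and "\<forall>p\<in>U. vector_derivative (\<lambda>r. motion \<sigma> \<xi> \<zeta> r (?X p)) (at 0 within I) \<bullet> N p
        = mean_curvature (\<lambda>p. motion \<sigma> \<xi> \<zeta> 0 (?X p)) N p"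
      using sol unfolding self_similar_solution_def by blast
    then have "?curvature s" if "(u, s) \<in> U" for u s
      using key[OF data \<open>0 \<in> I\<close> that \<sigma>' \<zeta>' _ _ N] \<open>\<sigma> 0 = 1\<close> that by simp
    then show "\<forall>s\<in>snd ` U. ?curvature s"
      by auto
  next
    assume curvature: "\<forall>s\<in>snd ` U. ?curvature s"
    obtain I \<sigma> \<zeta> where data: "motion_data I \<sigma> (\<lambda>_. 0) \<zeta>"
      and \<sigma>': "\<forall>t\<in>I. (\<sigma> has_real_derivative c / \<sigma> t) (at t within I)"
      and \<zeta>': "\<forall>t\<in>I. (\<zeta> has_real_derivative b / \<sigma> t) (at t within I)"
      by (rule motion_with_constant_rates_exists)
    note \<sigma>' = bspec[OF \<sigma>'] and \<zeta>' = bspec[OF \<zeta>']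
    let ?L = "motion \<sigma> (\<lambda>_. 0) \<zeta>"
    have 0: "0 \<in> I" "\<sigma> 0 = 1" "\<zeta> 0 = 0" and pos: "\<And>t. t \<in> I \<Longrightarrow> \<sigma> t > 0"
      using data by (auto simp: motion_data_def)
    have "(vertical_translation \<zeta> has_vector_derivative b *\<^sub>R e3) (at 0 within I)"
    proof -
      have "((\<lambda>t. cyl 0 0 (\<zeta> t) 0) has_vector_derivative cyl (0 - 0 * 0) (0 + 0 * 0) (b / \<sigma> 0) 0) (at 0 within I)"
        by (rule has_vector_derivative_cyl) (use \<zeta>'[OF 0(1)] in auto)
      moreover have "(\<lambda>t. cyl 0 0 (\<zeta> t) 0) = vertical_translation \<zeta>" "cyl 0 0 b 0 = b *\<^sub>R e3"
        by (simp_all add: fun_eq_iff cyl_def vertical_translation_def e3_def vec_eq_iff forall_3)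
      ultimately show ?thesis using 0 by simp
    qed
    then have "homothetic_helicoidal_motion I ?L c b"
      using data \<sigma>'[OF 0(1)] 0 unfolding homothetic_helicoidal_motion_def by auto
    moreover have "?L 0 (?X p) = ?X p" for p
      using 0 motion_surface_of_revolution[of \<sigma> "\<lambda>_. 0" \<zeta> 0 \<phi> \<psi>]
      by (cases p) (simp flip: surface_of_revolution_eq_cyl)
    moreover have "self_similar_solution I U (\<lambda>t p. ?L t (?X p))"
      unfolding self_similar_solution_def
    proof
      fix t assume t: "t \<in> I"
      obtain N where N: "unit_normal_on U (\<lambda>p. ?L t (?X p)) N"
        using unit_normal_rotational_exists[where \<sigma> = \<sigma> and t = t, OF assms pos[OF t]] .
      have "vector_derivative (\<lambda>r. ?L r (?X p)) (at t within I) \<bullet> N p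
          = mean_curvature (\<lambda>p. ?L t (?X p)) N p" if "p \<in> U" for p
        using key[OF data t _ \<sigma>'[OF t] \<zeta>'[OF t] _ _ N, of "fst p" "snd p"] pos[OF t] curvature that
        by auto
      with N show "\<exists>N. unit_normal_on U (\<lambda>p. ?L t (?X p)) N \<and> (\<forall>p\<in>U.
          vector_derivative (\<lambda>r. ?L r (?X p)) (at t within I) \<bullet> N p = mean_curvature (\<lambda>p. ?L t (?X p)) N p)"
        by blast
    qed
    ultimately show ?flow
      unfolding mcf_initial_datum_def by blast
  qed
qed

end
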